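(* Assume that the system $y(t+1)=f(y(t),u(t),\sigma(t))$ satisfies the strong $h$-approximation conditions for any vector function $h=(q_1,\dots,q_j)$. Then the optimal value $F^\epsilon=\inf_{\pi\in\Pi}E[G(z_\epsilon^{\pi}(1))]$ converges to the optimal value $F^0=\inf_{\{z(\cdot)\}}G(z(1))$ (infimum over the solutions of the differential inclusion $\dot z(s)\in V_g(z(s))$, $z(0)=z_0$) as $\epsilon\to0$. More precisely, $$|F^\epsilon-F^0|\le C_G\,\psi(\epsilon),$$ where $\psi(\epsilon)=\max(\psi_1(\epsilon),\psi_2(\epsilon))$, with $\psi_1$ and $\psi_2$ the approximation bounds described in the context. In addition, if $\bar z(\cdot)$ is an optimal solution of the problem $F^0=\inf_{\{z(\cdot)\}}G(z(1))$, then the control plan $\bar\pi\in\Pi$ constructed from $\bar z(\cdot)$ as described in the context generates the solution $z_\epsilon^{\bar\pi}(\cdot)$ of the hybrid system such that $$E[G(z_\epsilon^{\bar\pi}(1))]\le F^\epsilon+C_G(\psi(\epsilon)+\psi_2(\epsilon)).$$ That is, the control plan $\bar\pi$ is asymptotically optimal for the problem $F^\epsilon=\inf_{\pi\in\Pi}E[G(z_\epsilon^{\pi}(1))]$.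
   Context: Discrete-time system. $Y\subset\mathbb R^m$ is compact, $\hat U$ and $S$ are compact metric spaces, $f:Y\times\hat U\times S\to\mathbb R^m$ is continuous, and $f(y,u,\sigma)\in Y$ for all $(y,u,\sigma)\in Y\times\hat U\times S$. $\sigma(0),\sigma(1),\dots$ are i.i.d. random elements of $S$ defined on a common probability space; $\sigma$ denotes a random element with their common law, and $E$ is the expectation. The system is $y(t+1)=f(y(t),u(t),\sigma(t))$, $y(0)=y_0\in Y$. A control plan is a sequence $\pi=\{\pi_t\}_{t\ge0}$ with $\pi_0\in\hat U$ and $\pi_t:S^t\to\hat U$ Borel measurable for $t\ge1$; the controls are $u(0)=\pi_0$, $u(t)=\pi_t(\sigma(0),\dots,\sigma(t-1))$; $(y^{\pi,y_0}(\cdot),u^{\pi,y_0}(\cdot))$ is the resulting state-control trajectory. For the hybrid system with small parameter $\epsilon>0$, control plans are considered on $t=0,1,\dots,\lfloor1/\epsilon\rfloor$, and $\Pi$ is the set of all such plans. Strong $h$-approximation conditions. $q_1,q_2,\dots$ is a sequence of Lipschitz continuous functions dense in the unit ball of $C(Y\times\hat U)$, and $h=(q_1,\dots,q_j):Y\times\hat U\to\mathbb R^j$. The conditions are said to be satisfied if, corresponding to any $y_0'\in Y$, any control plan $\pi'$ and any other $y_0''\in Y$, there exists a control plan $\pi''$ such that $$E\Big[\Big\|\tfrac1T\sum_{t=0}^{T}h(y^{\pi',y_0'}(t),u^{\pi',y_0'}(t))-\tfrac1T\sum_{t=0}^{T}h(y^{\pi'',y_0''}(t),u^{\pi'',y_0''}(t))\Big\|\Big]\le\nu_h(T)$$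 for some monotone decreasing $\nu_h:[0,\infty)\to[0,\infty)$ with $\lim_{T\to\infty}\nu_h(T)=0$. Hybrid system. For $\pi\in\Pi$ (with $y_0$ suppressed in the notation), $z_\epsilon^{\pi}(\cdot)$ is the solution on $[0,1]$ of $\dot z_\epsilon(s)=g(z_\epsilon(s),y_\epsilon(s),u_\epsilon(s))$, $z_\epsilon(0)=z_0\in\mathbb R^n$, where $y_\epsilon(s)=y^{\pi,y_0}(t)$ and $u_\epsilon(s)=u^{\pi,y_0}(t)$ for $s\in[\epsilon t,\epsilon(t+1))$, $t=0,1,\dots,\lfloor1/\epsilon\rfloor$. The function $g:\mathbb R^n\times Y\times\hat U\to\mathbb R^n$ is continuous and satisfies a Lipschitz condition in $z$ on a sufficiently large compact set $Z\subset\mathbb R^n$ that contains all the solutions of the hybrid system in its interior: for some $C>0$, $\|g(z_1,y,u)-g(z_2,y,u)\|\le C\|z_1-z_2\|$ for all $z_1,z_2\in Z$, $y\in Y$, $u\in\hat U$. $G:Z\to\mathbb R$ is Lipschitz continuous with Lipschitz constant $C_G$. Stationary measures and $V_g$. $W$ is the set of Borel probability measures $\gamma$ on $Y\times\hat U$ such that $\int_{Y\times\hat U}(E[\varphi(f(y,u,\sigma))]-\varphi(y))\,\gamma(dy,du)=0$ for all $\varphi\in C(Y)$, and $V_g(z)=\bigcup_{\gamma\in W}\big\{\int_{Y\times\hat U}g(z,y,u)\,\gamma(dy,du)\big\}$. A solution of the differential inclusion is an absolutely continuous function on $[0,1]$ with $z(0)=z_0$ satisfying the inclusion for almost all $s\in[0,1]$.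 The bounds $\psi_1,\psi_2$. These are the functions, both tending to $0$ as $\epsilon\to0$, in the following two approximation properties. (1) For an arbitrary control plan $\pi\in\Pi$ there exists $z_\epsilon(\cdot)$, a solution of the differential inclusion, such that $\max_{s\in[0,1]}E\|z_\epsilon^{\pi}(s)-z_\epsilon(s)\|\le\psi_1(\epsilon)$. (2) Under the strong $h$-approximation conditions for any $h$, corresponding to any solution $\bar z(\cdot)$ of the differential inclusion there exists a control plan $\bar\pi$, namely the one constructed below, such that $\max_{s\in[0,1]}E\|z_\epsilon^{\bar\pi}(s)-\bar z(s)\|\le\psi_2(\epsilon)$. Construction of $\bar\pi$ from a solution $\bar z(\cdot)$ of the differential inclusion. Choose a function $\Delta(\epsilon)$ with $\Delta(\epsilon)\to0$ and $\Delta(\epsilon)/\epsilon\to\infty$ as $\epsilon\to0$. Put $N(\epsilon)=\lfloor1/\Delta(\epsilon)\rfloor$, $\tau_t=t\Delta(\epsilon)$ for $t=0,\dots,N(\epsilon)$, and $K(\epsilon)=\min_{t=0,\dots,N(\epsilon)-1}(\lfloor\tau_{t+1}/\epsilon\rfloor-\lfloor\tau_t/\epsilon\rfloor)$. For $t=0,\dots,N(\epsilon)-1$ successively, let $v_t$ be the projection of $\Delta(\epsilon)^{-1}\int_{\tau_t}^{\tau_{t+1}}\dot{\bar z}(s)\,ds$ onto $V_g(\bar z(\tau_t))$. With $y^t$ denoting the state $y(\lfloor\tau_t/\epsilon\rfloor)$ ($y^0=y_0$), let $\pi^t=(\pi^t_k)$, $k=\lfloor\tau_t/\epsilon\rfloor,\dots,\lfloor\tau_t/\epsilon\rfloor+K(\epsilon)-1$,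 be a control plan started at time $\lfloor\tau_t/\epsilon\rfloor$ from $y^t$ (its first entry is an element of $\hat U$, and $\pi^t_k$ is a function of $\sigma(\lfloor\tau_t/\epsilon\rfloor),\dots,\sigma(k-1)$ for later $k$) whose state-control trajectory $(y^{\pi^t}(\cdot),u^{\pi^t}(\cdot))$ satisfies $$E\Big[\Big\|v_t-\tfrac1{K(\epsilon)}\sum_{m=\lfloor\tau_t/\epsilon\rfloor}^{\lfloor\tau_t/\epsilon\rfloor+K(\epsilon)-1}g(\bar z(\tau_t),y^{\pi^t}(m),u^{\pi^t}(m))\Big\|\Big]\le\bar\nu_g(K(\epsilon)),$$ where $\bar\nu_g$ is a function with $\lim_{\epsilon\to0}\bar\nu_g(K(\epsilon))=0$ (such plans exist under the strong $h$-approximation conditions). Set $\bar\pi_k=\pi^t_k$ for $k=\lfloor\tau_t/\epsilon\rfloor,\dots,\lfloor\tau_t/\epsilon\rfloor+K(\epsilon)-1$, and let $\bar\pi_k$ be an arbitrary element of $\hat U$ for $k=\lfloor\tau_t/\epsilon\rfloor+K(\epsilon),\dots,\lfloor\tau_{t+1}/\epsilon\rfloor-1$. Finally, let $\bar\pi_k$ be an arbitrary element of $\hat U$ for $k=\lfloor\tau_{N(\epsilon)}/\epsilon\rfloor,\dots,\lfloor1/\epsilon\rfloor$. *)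

theory Defs
  imports "HOL-Probability.Probability"
begin

section \<open>The discrete-time system\<close>

text \<open>The entry \<open>\<pi> t\<close> of a control plan is a function of the noise values with indices in
  \<open>{..<t}\<close>. For \<open>t = 0\<close> the product space has a single point, so \<open>\<pi> 0\<close> amounts to
  an element of the control space.\<close>

type_synonym ('s, 'u) plan = "nat \<Rightarrow> (nat \<Rightarrow> 's) \<Rightarrow> 'u"

definition plans ::
    "nat set \<Rightarrow> ('s::topological_space, 'u::topological_space) plan set" where
  "plans I = {\<pi>. \<forall>t\<in>I. \<pi> t \<in> borel_measurable (PiM {..<t} (\<lambda>_. borel))}"

definition control :: "('s, 'u) plan \<Rightarrow> (nat \<Rightarrow> 's) \<Rightarrow> nat \<Rightarrow> 'u" where
  "control \<pi> w t = \<pi> t (restrict w {..<t})"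

primrec state ::
    "('y \<Rightarrow> 'u \<Rightarrow> 's \<Rightarrow> 'y) \<Rightarrow> ('s, 'u) plan \<Rightarrow> 'y \<Rightarrow> (nat \<Rightarrow> 's) \<Rightarrow> nat \<Rightarrow> 'y" where
  "state f \<pi> y0 w 0 = y0"
| "state f \<pi> y0 w (Suc t) = f (state f \<pi> y0 w t) (control \<pi> w t) (w t)"

section \<open>Strong approximation conditions\<close>

text \<open>The sequence is indexed from 0, so \<open>q i\<close> is the function with number \<open>i + 1\<close> and
  \<open>h\<close> consists of the \<open>q i\<close> with \<open>i < j\<close>.\<close>

definition dense_in_unit_ball ::
    "'y::metric_space set \<Rightarrow> (nat \<Rightarrow> 'y \<times> 'u::metric_space \<Rightarrow> real) \<Rightarrow> bool" where
  "dense_in_unit_ball Y q \<longleftrightarrow>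
     (\<forall>i. continuous_on (Y \<times> UNIV) (q i) \<and> (\<forall>p \<in> Y \<times> UNIV. \<bar>q i p\<bar> \<le> 1)) \<and>
     (\<forall>\<phi>. continuous_on (Y \<times> UNIV) \<phi> \<and> (\<forall>p \<in> Y \<times> UNIV. \<bar>\<phi> p\<bar> \<le> 1) \<longrightarrow>
        (\<forall>e>0. \<exists>i. \<forall>p \<in> Y \<times> UNIV. \<bar>\<phi> p - q i p\<bar> \<le> e))"

definition strong_approximation ::
    "'w measure \<Rightarrow> (nat \<Rightarrow> 'w \<Rightarrow> 's::topological_space) \<Rightarrow> ('y \<Rightarrow> 'u \<Rightarrow> 's \<Rightarrow> 'y) \<Rightarrow> 'y set \<Rightarrow>
     (nat \<Rightarrow> 'y \<times> 'u::topological_space \<Rightarrow> real) \<Rightarrow> nat \<Rightarrow> bool" where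
  "strong_approximation M \<sigma> f Y q j \<longleftrightarrow>
     (\<exists>\<nu>::real \<Rightarrow> real.
        (\<forall>T\<ge>0. 0 \<le> \<nu> T) \<and> antimono_on {0..} \<nu> \<and> (\<nu> \<longlongrightarrow> 0) at_top \<and>
        (\<forall>y' \<in> Y. \<forall>\<pi>' \<in> plans UNIV. \<forall>y'' \<in> Y. \<exists>\<pi>'' \<in> plans UNIV. \<forall>T::nat. 1 \<le> T \<longrightarrow>
           (\<integral>\<omega>. L2_set (\<lambda>i.
               (1 / real T) * (\<Sum>t=0..T. q i (state f \<pi>' y' (\<lambda>k. \<sigma> k \<omega>) t, control \<pi>' (\<lambda>k. \<sigma> k \<omega>) t))
             - (1 / real T) * (\<Sum>t=0..T. q i (state f \<pi>'' y'' (\<lambda>k. \<sigma> k \<omega>) t, control \<pi>'' (\<lambda>k. \<sigma> k \<omega>) t)))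
             {..<j} \<partial>M) \<le> \<nu> (real T)))"

section \<open>The hybrid system\<close>

definition horizon :: "real \<Rightarrow> nat" where
  "horizon \<epsilon> = nat \<lfloor>1 / \<epsilon>\<rfloor>"

text \<open>The right-hand side jumps only at the times \<open>\<epsilon> t\<close>. A solution is continuous and satisfies
  the equation at all other times of the unit interval.\<close>

definition hybrid_solution ::
    "('y \<Rightarrow> 'u \<Rightarrow> 's \<Rightarrow> 'y) \<Rightarrow> ('n::real_normed_vector \<Rightarrow> 'y \<Rightarrow> 'u \<Rightarrow> 'n) \<Rightarrow> 'y \<Rightarrow> 'n \<Rightarrow>
     real \<Rightarrow> ('s, 'u) plan \<Rightarrow> (nat \<Rightarrow> 's) \<Rightarrow> (real \<Rightarrow> 'n) \<Rightarrow> bool" where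
  "hybrid_solution f g y0 z0 \<epsilon> \<pi> w \<zeta> \<longleftrightarrow>
     \<zeta> 0 = z0 \<and> continuous_on {0..1} \<zeta> \<and>
     (\<forall>s \<in> {0..1} - range (\<lambda>t::nat. \<epsilon> * real t).
        (\<zeta> has_vector_derivative
           g (\<zeta> s) (state f \<pi> y0 w (nat \<lfloor>s / \<epsilon>\<rfloor>)) (control \<pi> w (nat \<lfloor>s / \<epsilon>\<rfloor>)))
        (at s within {0..1}))"

text \<open>Under the Lipschitz condition on \<open>g\<close> the values on the unit interval do not depend on the
  choice.\<close>

definition hybrid_traj ::
    "('y \<Rightarrow> 'u \<Rightarrow> 's \<Rightarrow> 'y) \<Rightarrow> ('n::real_normed_vector \<Rightarrow> 'y \<Rightarrow> 'u \<Rightarrow> 'n) \<Rightarrow> 'y \<Rightarrow> 'n \<Rightarrow>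
     real \<Rightarrow> ('s, 'u) plan \<Rightarrow> (nat \<Rightarrow> 's) \<Rightarrow> real \<Rightarrow> 'n" where
  "hybrid_traj f g y0 z0 \<epsilon> \<pi> w = (SOME \<zeta>. hybrid_solution f g y0 z0 \<epsilon> \<pi> w \<zeta>)"

definition expected_cost ::
    "'w measure \<Rightarrow> (nat \<Rightarrow> 'w \<Rightarrow> 's) \<Rightarrow> ('y \<Rightarrow> 'u \<Rightarrow> 's \<Rightarrow> 'y) \<Rightarrow>
     ('n::real_normed_vector \<Rightarrow> 'y \<Rightarrow> 'u \<Rightarrow> 'n) \<Rightarrow> 'y \<Rightarrow> 'n \<Rightarrow> ('n \<Rightarrow> real) \<Rightarrow>
     real \<Rightarrow> ('s, 'u) plan \<Rightarrow> real" where
  "expected_cost M \<sigma> f g y0 z0 G \<epsilon> \<pi> = (\<integral>\<omega>. G (hybrid_traj f g y0 z0 \<epsilon> \<pi> (\<lambda>k. \<sigma> k \<omega>) 1) \<partial>M)"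

definition optimal_hybrid_value ::
    "'w measure \<Rightarrow> (nat \<Rightarrow> 'w \<Rightarrow> 's::topological_space) \<Rightarrow>
     ('y \<Rightarrow> 'u::topological_space \<Rightarrow> 's \<Rightarrow> 'y) \<Rightarrow>
     ('n::real_normed_vector \<Rightarrow> 'y \<Rightarrow> 'u \<Rightarrow> 'n) \<Rightarrow> 'y \<Rightarrow> 'n \<Rightarrow> ('n \<Rightarrow> real) \<Rightarrow> real \<Rightarrow> real" where
  "optimal_hybrid_value M \<sigma> f g y0 z0 G \<epsilon> =
     (INF \<pi> \<in> plans {..horizon \<epsilon>}. expected_cost M \<sigma> f g y0 z0 G \<epsilon> \<pi>)"

section \<open>Stationary measures and the differential inclusion\<close>

definition stationary_measures ::
    "'w measure \<Rightarrow> (nat \<Rightarrow> 'w \<Rightarrow> 's) \<Rightarrow>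
     ('y::topological_space \<Rightarrow> 'u::topological_space \<Rightarrow> 's \<Rightarrow> 'y) \<Rightarrow> 'y set \<Rightarrow>
     ('y \<times> 'u) measure set" where
  "stationary_measures M \<sigma> f Y =
     {\<gamma>. prob_space \<gamma> \<and> space \<gamma> = Y \<times> UNIV \<and> sets \<gamma> = sets (restrict_space borel (Y \<times> UNIV)) \<and>
         (\<forall>\<phi>::'y \<Rightarrow> real. continuous_on Y \<phi> \<longrightarrow>
            (\<integral>p. ((\<integral>\<omega>. \<phi> (f (fst p) (snd p) (\<sigma> 0 \<omega>)) \<partial>M) - \<phi> (fst p)) \<partial>\<gamma>) = 0)}"

definition averaged_velocities ::
    "'w measure \<Rightarrow> (nat \<Rightarrow> 'w \<Rightarrow> 's) \<Rightarrow>
     ('y::topological_space \<Rightarrow> 'u::topological_space \<Rightarrow> 's \<Rightarrow> 'y) \<Rightarrow> 'y set \<Rightarrow>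
     ('n::{banach, second_countable_topology} \<Rightarrow> 'y \<Rightarrow> 'u \<Rightarrow> 'n) \<Rightarrow> 'n \<Rightarrow> 'n set" where
  "averaged_velocities M \<sigma> f Y g z =
     (\<lambda>\<gamma>. \<integral>p. g z (fst p) (snd p) \<partial>\<gamma>) ` stationary_measures M \<sigma> f Y"

definition abs_continuous_on_interval ::
    "real \<Rightarrow> real \<Rightarrow> (real \<Rightarrow> 'n::real_normed_vector) \<Rightarrow> bool" where
  "abs_continuous_on_interval a b z \<longleftrightarrow>
     (\<forall>e>0. \<exists>d>0. \<forall>D. finite D \<and> (\<forall>(l, r) \<in> D. a \<le> l \<and> l < r \<and> r \<le> b) \<and>
        disjoint_family_on (\<lambda>(l, r). {l<..<r}) D \<and> (\<Sum>(l, r)\<in>D. r - l) < d \<longrightarrow>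
        (\<Sum>(l, r)\<in>D. norm (z r - z l)) < e)"

definition inclusion_solution ::
    "('n::real_normed_vector \<Rightarrow> 'n set) \<Rightarrow> 'n \<Rightarrow> (real \<Rightarrow> 'n) \<Rightarrow> bool" where
  "inclusion_solution V z0 z \<longleftrightarrow>
     abs_continuous_on_interval 0 1 z \<and> z 0 = z0 \<and>
     (AE s in lebesgue. s \<in> {0..1} \<longrightarrow> (\<exists>v \<in> V (z s). (z has_vector_derivative v) (at s)))"

definition optimal_averaged_value ::
    "('n::real_normed_vector \<Rightarrow> 'n set) \<Rightarrow> 'n \<Rightarrow> ('n \<Rightarrow> real) \<Rightarrow> real" where
  "optimal_averaged_value V z0 G = (INF z \<in> {z. inclusion_solution V z0 z}. G (z 1))"

section \<open>The plan constructed from a solution of the inclusion\<close>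

text \<open>In this section \<open>d\<close> stands for \<open>\<Delta> \<epsilon>\<close>, and \<open>block_start \<epsilon> d t\<close> is the integer part of
  \<open>t d / \<epsilon>\<close>.\<close>

definition num_blocks :: "real \<Rightarrow> nat" where
  "num_blocks d = nat \<lfloor>1 / d\<rfloor>"

definition block_start :: "real \<Rightarrow> real \<Rightarrow> nat \<Rightarrow> nat" where
  "block_start \<epsilon> d t = nat \<lfloor>(real t * d) / \<epsilon>\<rfloor>"

definition block_length :: "real \<Rightarrow> real \<Rightarrow> nat" where
  "block_length \<epsilon> d =
     Min ((\<lambda>t. block_start \<epsilon> d (Suc t) - block_start \<epsilon> d t) ` {..<num_blocks d})"

definition block_velocity ::
    "('n::euclidean_space \<Rightarrow> 'n set) \<Rightarrow> real \<Rightarrow> (real \<Rightarrow> 'n) \<Rightarrow> nat \<Rightarrow> 'n" where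
  "block_velocity V d zbar t =
     closest_point (V (zbar (real t * d)))
       ((1 / d) *\<^sub>R integral {real t * d..real (Suc t) * d} (\<lambda>s. vector_derivative zbar (at s)))"

text \<open>On each block the plan restarts from the state reached at the beginning of the block:
  \<open>P y\<close> is the plan used on the block when that state is \<open>y\<close>, and it sees only the noise of the
  block. Since this state is random, \<open>P\<close> may depend on it. The trajectory of \<open>P\<close> on the
  block is that of \<open>\<pi>\<close> itself.\<close>

definition constructed_plan ::
    "'w measure \<Rightarrow> (nat \<Rightarrow> 'w \<Rightarrow> 's::topological_space) \<Rightarrow>
     ('y::topological_space \<Rightarrow> 'u::topological_space \<Rightarrow> 's \<Rightarrow> 'y) \<Rightarrow> 'y set \<Rightarrow>
     ('n::euclidean_space \<Rightarrow> 'y \<Rightarrow> 'u \<Rightarrow> 'n) \<Rightarrow> 'y \<Rightarrow> (nat \<Rightarrow> real) \<Rightarrow>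
     real \<Rightarrow> real \<Rightarrow> (real \<Rightarrow> 'n) \<Rightarrow> ('s, 'u) plan \<Rightarrow> bool" where
  "constructed_plan M \<sigma> f Y g y0 \<nu> \<epsilon> d zbar \<pi> \<longleftrightarrow>
     \<pi> \<in> plans {..horizon \<epsilon>} \<and>
     (\<forall>t < num_blocks d.
        (\<exists>P :: 'y \<Rightarrow> ('s, 'u) plan.
           \<forall>k \<in> {block_start \<epsilon> d t..<block_start \<epsilon> d t + block_length \<epsilon> d}.
             (\<forall>y \<in> Y. P y k \<in> borel_measurable (PiM {block_start \<epsilon> d t..<k} (\<lambda>_. borel))) \<and>
             (\<forall>w. control \<pi> w k =
                P (state f \<pi> y0 w (block_start \<epsilon> d t)) k (restrict w {block_start \<epsilon> d t..<k}))) \<and>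
        (\<integral>\<omega>. norm (block_velocity (averaged_velocities M \<sigma> f Y g) d zbar t -
              (1 / real (block_length \<epsilon> d)) *\<^sub>R
              (\<Sum>m \<in> {block_start \<epsilon> d t..<block_start \<epsilon> d t + block_length \<epsilon> d}.
                 g (zbar (real t * d)) (state f \<pi> y0 (\<lambda>k. \<sigma> k \<omega>) m) (control \<pi> (\<lambda>k. \<sigma> k \<omega>) m)))
           \<partial>M) \<le> \<nu> (block_length \<epsilon> d) \<and>
        (\<forall>k \<in> {block_start \<epsilon> d t + block_length \<epsilon> d..<block_start \<epsilon> d (Suc t)}.
           \<exists>c. \<forall>w. control \<pi> w k = c)) \<and>
     (\<forall>k \<in> {block_start \<epsilon> d (num_blocks d)..horizon \<epsilon>}. \<exists>c. \<forall>w. control \<pi> w k = c)"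

section \<open>The two approximation properties\<close>

text \<open>The approximating solution may depend on the random outcome; a deterministic solution is the
  special case of a constant family.\<close>

definition approximation_bound_1 ::
    "'w measure \<Rightarrow> (nat \<Rightarrow> 'w \<Rightarrow> 's::topological_space) \<Rightarrow>
     ('y::topological_space \<Rightarrow> 'u::topological_space \<Rightarrow> 's \<Rightarrow> 'y) \<Rightarrow> 'y set \<Rightarrow>
     ('n::euclidean_space \<Rightarrow> 'y \<Rightarrow> 'u \<Rightarrow> 'n) \<Rightarrow> 'y \<Rightarrow> 'n \<Rightarrow> real \<Rightarrow> (real \<Rightarrow> real) \<Rightarrow> bool" where
  "approximation_bound_1 M \<sigma> f Y g y0 z0 \<epsilon>0 \<psi> \<longleftrightarrow>
     (\<psi> \<longlongrightarrow> 0) (at_right 0) \<and>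
     (\<forall>\<epsilon> \<in> {0<..<\<epsilon>0}. \<forall>\<pi> \<in> plans {..horizon \<epsilon>}. \<exists>z.
        (\<forall>\<omega> \<in> space M. inclusion_solution (averaged_velocities M \<sigma> f Y g) z0 (z \<omega>)) \<and>
        (\<forall>s \<in> {0..1}. (\<lambda>\<omega>. z \<omega> s) \<in> borel_measurable M \<and>
           (\<integral>\<omega>. norm (hybrid_traj f g y0 z0 \<epsilon> \<pi> (\<lambda>k. \<sigma> k \<omega>) s - z \<omega> s) \<partial>M) \<le> \<psi> \<epsilon>))"

definition approximation_bound_2 ::
    "'w measure \<Rightarrow> (nat \<Rightarrow> 'w \<Rightarrow> 's::topological_space) \<Rightarrow>
     ('y::topological_space \<Rightarrow> 'u::topological_space \<Rightarrow> 's \<Rightarrow> 'y) \<Rightarrow> 'y set \<Rightarrow>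
     ('n::euclidean_space \<Rightarrow> 'y \<Rightarrow> 'u \<Rightarrow> 'n) \<Rightarrow> 'y \<Rightarrow> 'n \<Rightarrow>
     (nat \<Rightarrow> 'y \<times> 'u \<Rightarrow> real) \<Rightarrow> (real \<Rightarrow> real) \<Rightarrow> (nat \<Rightarrow> real) \<Rightarrow> real \<Rightarrow> (real \<Rightarrow> real) \<Rightarrow> bool" where
  "approximation_bound_2 M \<sigma> f Y g y0 z0 q \<Delta> \<nu> \<epsilon>0 \<psi> \<longleftrightarrow>
     (\<psi> \<longlongrightarrow> 0) (at_right 0) \<and>
     ((\<forall>j. strong_approximation M \<sigma> f Y q j) \<longrightarrow>
      (\<forall>\<epsilon> \<in> {0<..<\<epsilon>0}. \<forall>zbar.
         inclusion_solution (averaged_velocities M \<sigma> f Y g) z0 zbar \<longrightarrow>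
         (\<exists>\<pi>. constructed_plan M \<sigma> f Y g y0 \<nu> \<epsilon> (\<Delta> \<epsilon>) zbar \<pi>) \<and>
         (\<forall>\<pi>. constructed_plan M \<sigma> f Y g y0 \<nu> \<epsilon> (\<Delta> \<epsilon>) zbar \<pi> \<longrightarrow>
            (\<forall>s \<in> {0..1}.
               (\<integral>\<omega>. norm (hybrid_traj f g y0 z0 \<epsilon> \<pi> (\<lambda>k. \<sigma> k \<omega>) s - zbar s) \<partial>M) \<le> \<psi> \<epsilon>))))"

end

theory Submission
  imports Defs
begin

text \<open>Both approximation properties compare endpoints in mean, so a Lipschitz cost changes by at most
  \<open>C\<^sub>G\<close> times the bound. Integrating this comparison requires that the endpoint of the hybrid
  trajectory, which is chosen separately for each outcome, be measurable. Between two jumps the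
  equation is autonomous, and as long as a solution stays in the interior of \<open>Z\<close>, where the
  right-hand side is Lipschitz, it is the pointwise limit of its Euler polygons; these are measurable
  in the outcome.\<close>

section \<open>Euler polygons of an autonomous equation\<close>

lemma differentiable_increment_bound:
  fixes \<zeta> :: "real \<Rightarrow> 'a::real_normed_vector"
  assumes "a \<le> b" and cont: "continuous_on {a..b} \<zeta>"
    and der: "\<And>r. r \<in> {a<..<b} \<Longrightarrow> (\<zeta> has_vector_derivative F r) (at r)"
    and bd: "\<And>r. r \<in> {a<..<b} \<Longrightarrow> norm (F r - v) \<le> B"
  shows "norm (\<zeta> b - \<zeta> a - (b - a) *\<^sub>R v) \<le> (b - a) * B"
proof (cases "a = b")
  case False
  then have "a < b" using assms by simp
  \<comment> \<open>Subtracting the linear function with slope \<open>v\<close> leaves a function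
    whose derivative is bounded by \<open>B\<close>, and the mean value inequality applies to
    it.\<close>
  have "norm ((\<zeta> b - b *\<^sub>R v) - (\<zeta> a - a *\<^sub>R v)) \<le> b * B - a * B"
  proof (rule differentiable_bound_general[OF \<open>a < b\<close>])
    show "continuous_on {a..b} (\<lambda>r. \<zeta> r - r *\<^sub>R v)"
      by (intro continuous_intros cont)
    show "((\<lambda>r. r * B) has_vector_derivative B) (at x)" for x
      by (auto intro!: derivative_eq_intros)
    show "((\<lambda>r. \<zeta> r - r *\<^sub>R v) has_vector_derivative F r - v) (at r)" if "a < r" "r < b" for r
      using that by (auto intro!: derivative_eq_intros der)
  qed (use bd in \<open>auto intro!: continuous_intros\<close>)
  then show ?thesis by (simp add: algebra_simps)
qed simp

text \<open>Each Euler step of length \<open>h\<close> adds a local error of at most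
  \<open>h * \<tau>\<close>, where \<open>\<tau>\<close> bounds the variation of \<open>F\<close>
  along the solution over one step; a discrete Gronwall argument controls the sum. Since
  \<open>F\<close> is Lipschitz only on \<open>Z\<close>, the same induction must keep the polygon
  in \<open>Z\<close>.\<close>

lemma euler_tendsto:
  fixes \<zeta> :: "real \<Rightarrow> 'a::real_normed_vector"
  assumes "a \<le> b" and cont: "continuous_on {a..b} \<zeta>"
    and der: "\<And>r. r \<in> {a<..<b} \<Longrightarrow> (\<zeta> has_vector_derivative F (\<zeta> r)) (at r)"
    and sub: "\<zeta> ` {a..b} \<subseteq> interior Z"
    and lip: "C-lipschitz_on Z F"
  shows "(\<lambda>N. ((\<lambda>x. x + ((b - a) / real N) *\<^sub>R F x) ^^ N) (\<zeta> a)) \<longlonglongrightarrow> \<zeta> b"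
proof (rule LIMSEQ_I)
  fix \<eta> :: real assume "\<eta> > 0"
  \<comment> \<open>By compactness the solution has a uniform margin: every point within
    \<open>\<delta>\<close> of its graph values is still in \<open>Z\<close>.\<close>
  have "compact (\<zeta> ` {a..b})" by (intro compact_continuous_image cont compact_Icc)
  then obtain \<delta> where "\<delta> > 0" and \<delta>: "(\<Union>x\<in>\<zeta> ` {a..b}. ball x \<delta>) \<subseteq> interior Z"
    using compact_subset_open_imp_ball_epsilon_subset sub by (metis open_interior)
  have "C \<ge> 0" using lip by (rule lipschitz_on_nonneg)
  \<comment> \<open>The factor \<open>(b - a) * exp (C * (b - a))\<close> amplifies
    \<open>\<tau>\<close> to the global error. The summand 1 keeps \<open>\<kappa>\<close> positive
    when \<open>a = b\<close> and makes the inequality \<open>small\<close> strict.\<close>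
  define \<kappa> where "\<kappa> = (b - a) * exp (C * (b - a)) + 1"
  have "\<kappa> > 0" unfolding \<kappa>_def using \<open>a \<le> b\<close> by (smt (verit) exp_gt_zero mult_nonneg_nonneg)
  define \<tau> where "\<tau> = min \<eta> \<delta> / \<kappa>"
  have "\<tau> > 0" using \<open>\<eta> > 0\<close> \<open>\<delta> > 0\<close> \<open>\<kappa> > 0\<close> by (simp add: \<tau>_def)
  have "\<tau> * \<kappa> = min \<eta> \<delta>" using \<open>\<kappa> > 0\<close> by (simp add: \<tau>_def)
  moreover have "\<tau> * \<kappa> = (b - a) * \<tau> * exp (C * (b - a)) + \<tau>"
    by (simp add: \<kappa>_def algebra_simps)
  ultimately have small: "(b - a) * \<tau> * exp (C * (b - a)) < min \<eta> \<delta>"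
    using \<open>\<tau> > 0\<close> by linarith
  have "continuous_on Z F" using lip by (rule lipschitz_on_continuous_on)
  then have "continuous_on {a..b} (\<lambda>r. F (\<zeta> r))"
    using sub interior_subset[of Z] by (intro continuous_on_compose2[of Z F, OF _ cont]) auto
  then have "uniformly_continuous_on {a..b} (\<lambda>r. F (\<zeta> r))"
    by (intro compact_uniformly_continuous) auto
  then obtain d where "d > 0"
    and d: "\<And>r s. r \<in> {a..b} \<Longrightarrow> s \<in> {a..b} \<Longrightarrow> dist r s < d \<Longrightarrow> dist (F (\<zeta> r)) (F (\<zeta> s)) < \<tau>"
    unfolding uniformly_continuous_on_def using \<open>\<tau> > 0\<close> by meson
  obtain N0 where N0: "real N0 > (b - a) / d" using reals_Archimedean2 by blast
  show "\<exists>N0. \<forall>N\<ge>N0. norm (((\<lambda>x. x + ((b - a) / real N) *\<^sub>R F x) ^^ N) (\<zeta> a) - \<zeta> b) < \<eta>"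
  proof (intro exI allI impI)
    fix N assume "N0 + 1 \<le> N"
    define h where "h = (b - a) / real N"
    define x where "x k = ((\<lambda>x. x + h *\<^sub>R F x) ^^ k) (\<zeta> a)" for k
    have "h \<ge> 0" using \<open>a \<le> b\<close> by (simp add: h_def)
    have Nh: "real N * h = b - a" using \<open>N0 + 1 \<le> N\<close> by (simp add: h_def)
    have "(b - a) / d < real N" using N0 \<open>N0 + 1 \<le> N\<close> by linarith
    then have "h < d" using \<open>d > 0\<close> \<open>N0 + 1 \<le> N\<close> by (simp add: h_def field_simps)
    have kh: "real k * h \<le> b - a" if "k \<le> N" for k
      using mult_right_mono[of "real k" "real N" h] that \<open>h \<ge> 0\<close> Nh by simp
    \<comment> \<open>Accumulated local errors \<open>k * h * \<tau>\<close> times the Gronwall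
      factor at the \<open>k\<close>-th node.\<close>
    have err: "norm (x k - \<zeta> (a + real k * h)) \<le> real k * h * \<tau> * exp (C * (real k * h))" if "k \<le> N" for k
      using that
    proof (induction k)
      case 0
      then show ?case by (simp add: x_def)
    next
      case (Suc k)
      define s where "s = a + real k * h"
      have s1: "a + real (Suc k) * h = s + h" by (simp add: s_def algebra_simps)
      have s: "s \<in> {a..b}" "s + h \<in> {a..b}"
        using kh[of k] kh[of "Suc k"] Suc.prems \<open>h \<ge> 0\<close> by (auto simp: s_def algebra_simps)
      have IH: "norm (x k - \<zeta> s) \<le> real k * h * \<tau> * exp (C * (real k * h))"
        using Suc by (simp add: s_def)
      \<comment> \<open>The hypothesis at step \<open>k\<close> already yields an error below
        \<open>\<delta>\<close>, so \<open>x k\<close> lies in \<open>Z\<close> and the Lipschitz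
        condition may be used for the next step.\<close>
      also have "\<dots> \<le> (b - a) * \<tau> * exp (C * (b - a))"
        using kh[of k] Suc.prems \<open>h \<ge> 0\<close> \<open>\<tau> > 0\<close> \<open>C \<ge> 0\<close> \<open>a \<le> b\<close>
        by (intro mult_mono mult_right_mono) (auto intro: mult_left_mono)
      finally have "dist (\<zeta> s) (x k) < \<delta>" using small by (simp add: dist_norm norm_minus_commute)
      then have Z: "x k \<in> Z" "\<zeta> s \<in> Z"
        using \<delta> s(1) sub interior_subset[of Z] by (fastforce simp: subset_iff)+
      have inc: "norm (\<zeta> (s + h) - \<zeta> s - (s + h - s) *\<^sub>R F (\<zeta> s)) \<le> (s + h - s) * \<tau>"
      proof (rule differentiable_increment_bound[where F = "\<lambda>r. F (\<zeta> r)"])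
        show "continuous_on {s..s + h} \<zeta>" using s by (intro continuous_on_subset[OF cont]) auto
        show "norm (F (\<zeta> r) - F (\<zeta> s)) \<le> \<tau>" if "r \<in> {s<..<s + h}" for r
          using d[of r s] that s \<open>h < d\<close> by (auto simp: dist_norm)
      qed (use s der \<open>h \<ge> 0\<close> in auto)
      \<comment> \<open>New error: the old error, plus its effect on the slope, minus the local
        error of the step.\<close>
      have "x (Suc k) - \<zeta> (s + h) =
          (x k - \<zeta> s) + h *\<^sub>R (F (x k) - F (\<zeta> s)) - (\<zeta> (s + h) - \<zeta> s - h *\<^sub>R F (\<zeta> s))"
        by (simp add: x_def algebra_simps)
      also have "norm \<dots> \<le> norm (x k - \<zeta> s) + h * norm (F (x k) - F (\<zeta> s)) + h * \<tau>"
        using inc \<open>h \<ge> 0\<close> norm_triangle_ineq[of "x k - \<zeta> s" "h *\<^sub>R (F (x k) - F (\<zeta> s))"]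
        by (intro norm_triangle_le_diff) simp
      also have "h * norm (F (x k) - F (\<zeta> s)) \<le> h * (C * norm (x k - \<zeta> s))"
        using lipschitz_onD[OF lip Z] \<open>h \<ge> 0\<close> by (intro mult_left_mono) (auto simp: dist_norm)
      finally have "norm (x (Suc k) - \<zeta> (s + h)) \<le> (1 + h * C) * norm (x k - \<zeta> s) + h * \<tau>"
        by (simp add: algebra_simps)
      \<comment> \<open>Replacing \<open>1 + h * C\<close> by \<open>exp (C * h)\<close> and
        inflating the local error by a factor at least 1 gives both terms the same exponential, so
        they add up to the bound for \<open>Suc k\<close>.\<close>
      also have "\<dots> \<le> exp (C * h) * (real k * h * \<tau> * exp (C * (real k * h))) + h * \<tau> * exp (C * (real (Suc k) * h))"
      proof (rule add_mono)
        show "(1 + h * C) * norm (x k - \<zeta> s) \<le> exp (C * h) * (real k * h * \<tau> * exp (C * (real k * h)))"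
          using exp_ge_add_one_self[of "C * h"] IH by (intro mult_mono) (simp_all add: mult.commute)
        have "1 \<le> exp (C * (real (Suc k) * h))" using \<open>h \<ge> 0\<close> \<open>C \<ge> 0\<close> by simp
        then show "h * \<tau> \<le> h * \<tau> * exp (C * (real (Suc k) * h))"
          using mult_left_mono[of 1 _ "h * \<tau>"] \<open>h \<ge> 0\<close> \<open>\<tau> > 0\<close> by simp
      qed
      also have "\<dots> = real (Suc k) * h * \<tau> * exp (C * (real (Suc k) * h))"
        by (simp add: algebra_simps exp_add)
      finally show ?case by (simp only: s1)
    qed
    have "norm (x N - \<zeta> b) < \<eta>" using err[of N] small Nh by simp
    then show "norm (((\<lambda>x. x + ((b - a) / real N) *\<^sub>R F x) ^^ N) (\<zeta> a) - \<zeta> b) < \<eta>"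
      by (simp add: x_def h_def)
  qed
qed

section \<open>Measurability of trajectories in the random outcome\<close>

text \<open>Continuity is known only on a set such as \<open>Y\<close> or \<open>Z\<close>, so
  \<open>X\<close> is first regarded as a map into that subspace; \<open>A\<close> itself need not
  be Borel.\<close>

lemma measurable_continuous_on_comp:
  assumes "continuous_on A h" "X \<in> borel_measurable M" "\<And>\<omega>. \<omega> \<in> space M \<Longrightarrow> X \<omega> \<in> A"
  shows "(\<lambda>\<omega>. h (X \<omega>)) \<in> borel_measurable M"
proof -
  have "X \<in> measurable M (restrict_space borel A)"
    using assms by (intro measurable_restrict_space2) auto
  then show ?thesis
    using borel_measurable_continuous_on_restrict[OF assms(1)] by (rule measurable_compose)
qed

lemma measurable_control:
  assumes "\<And>k. \<sigma> k \<in> borel_measurable M" "\<pi> t \<in> borel_measurable (PiM {..<t} (\<lambda>_. borel))"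
  shows "(\<lambda>\<omega>. control \<pi> (\<lambda>k. \<sigma> k \<omega>) t) \<in> borel_measurable M"
  unfolding control_def using assms by (intro measurable_compose[OF measurable_restrict]) auto

lemma state_mem:
  assumes "y0 \<in> Y" "\<And>y u x. y \<in> Y \<Longrightarrow> f y u x \<in> Y"
  shows "state f \<pi> y0 w t \<in> Y"
  by (induction t) (auto simp: assms)

text \<open>Only plan entries with index below \<open>t\<close> influence the state at time
  \<open>t\<close>, so a plan measurable up to the horizon suffices there. Second countability makes
  tuples of Borel maps Borel.\<close>

lemma measurable_state:
  fixes f :: "'y::second_countable_topology \<Rightarrow> 'u::second_countable_topology \<Rightarrow>
      's::second_countable_topology \<Rightarrow> 'y"
  assumes \<sigma>: "\<And>k. \<sigma> k \<in> borel_measurable M"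
    and \<pi>: "\<And>k. k < t \<Longrightarrow> \<pi> k \<in> borel_measurable (PiM {..<k} (\<lambda>_. borel))"
    and Y: "y0 \<in> Y" "\<And>y u x. y \<in> Y \<Longrightarrow> f y u x \<in> Y"
    and f: "continuous_on (Y \<times> UNIV \<times> UNIV) (\<lambda>(y, u, x). f y u x)"
  shows "(\<lambda>\<omega>. state f \<pi> y0 (\<lambda>k. \<sigma> k \<omega>) t) \<in> borel_measurable M"
  using \<pi>
proof (induction t)
  case (Suc t)
  have "(\<lambda>\<omega>. (state f \<pi> y0 (\<lambda>k. \<sigma> k \<omega>) t, control \<pi> (\<lambda>k. \<sigma> k \<omega>) t, \<sigma> t \<omega>)) \<in> borel_measurable M"
    using Suc by (intro borel_measurable_Pair measurable_control \<sigma>) auto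
  from measurable_continuous_on_comp[OF f this] show ?case
    by (simp add: state_mem[OF Y])
qed simp

lemma measurable_euler:
  fixes g :: "'n::{real_normed_vector, second_countable_topology} \<Rightarrow> 'y::second_countable_topology \<Rightarrow>
      'u::second_countable_topology \<Rightarrow> 'n"
  assumes g: "continuous_on (UNIV \<times> Y \<times> UNIV) (\<lambda>(z, y, u). g z y u)"
    and "y \<in> borel_measurable M" "\<And>\<omega>. \<omega> \<in> space M \<Longrightarrow> y \<omega> \<in> Y"
    and "u \<in> borel_measurable M" "z \<in> borel_measurable M"
  shows "(\<lambda>\<omega>. ((\<lambda>x. x + c *\<^sub>R g x (y \<omega>) (u \<omega>)) ^^ k) (z \<omega>)) \<in> borel_measurable M"
proof (induction k)
  case (Suc k)
  let ?x = "\<lambda>\<omega>. ((\<lambda>x. x + c *\<^sub>R g x (y \<omega>) (u \<omega>)) ^^ k) (z \<omega>)"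
  have "(\<lambda>\<omega>. (?x \<omega>, y \<omega>, u \<omega>)) \<in> borel_measurable M"
    using Suc assms by (intro borel_measurable_Pair)
  from measurable_continuous_on_comp[OF g this]
  have "(\<lambda>\<omega>. g (?x \<omega>) (y \<omega>) (u \<omega>)) \<in> borel_measurable M" using assms by simp
  then show ?case using Suc by simp
qed (use assms in simp)

text \<open>Between two jump times state and control are frozen, so the equation is autonomous
  there. The end \<open>b\<close> may precede the next jump, to cover a last piece cut off at time
  1.\<close>

lemma hybrid_solution_euler_tendsto:
  fixes z0 :: "'n::real_normed_vector"
  assumes "0 < \<epsilon>" and sol: "hybrid_solution f g y0 z0 \<epsilon> \<pi> w \<zeta>"
    and "\<zeta> ` {0..1} \<subseteq> interior Z"
    and "C-lipschitz_on Z (\<lambda>z. g z (state f \<pi> y0 w t) (control \<pi> w t))"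
    and ab: "\<epsilon> * real t = a" "a \<le> b" "b \<le> \<epsilon> * real (Suc t)" "b \<le> 1"
  shows "(\<lambda>N. ((\<lambda>x. x + ((b - a) / real N) *\<^sub>R g x (state f \<pi> y0 w t) (control \<pi> w t)) ^^ N) (\<zeta> a))
    \<longlonglongrightarrow> \<zeta> b"
proof (rule euler_tendsto[where Z = Z and C = C])
  have "0 \<le> a" using ab \<open>0 < \<epsilon>\<close> by auto
  then have sub: "{a..b} \<subseteq> {0..1}" using ab by auto
  show "continuous_on {a..b} \<zeta>"
    using sol sub unfolding hybrid_solution_def by (blast intro: continuous_on_subset)
  show "\<zeta> ` {a..b} \<subseteq> interior Z" using assms(3) sub by blast
  show "(\<zeta> has_vector_derivative g (\<zeta> r) (state f \<pi> y0 w t) (control \<pi> w t)) (at r)"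
    if r: "r \<in> {a<..<b}" for r
  proof -
    have "\<lfloor>r / \<epsilon>\<rfloor> = int t"
      using r ab \<open>0 < \<epsilon>\<close> by (intro floor_unique) (auto simp: field_simps)
    then have fl: "nat \<lfloor>r / \<epsilon>\<rfloor> = t" by simp
    \<comment> \<open>The only multiple of \<open>\<epsilon>\<close> with quotient \<open>t\<close>
      is \<open>a\<close> itself, which lies to the left of \<open>r\<close>.\<close>
    have "r \<notin> range (\<lambda>t::nat. \<epsilon> * real t)"
    proof
      assume "r \<in> range (\<lambda>t::nat. \<epsilon> * real t)"
      then obtain k :: nat where k: "r = \<epsilon> * real k" by blast
      then have "k = t" using fl \<open>0 < \<epsilon>\<close> by simp
      then show False using r ab k by simp
    qed
    moreover have "r \<in> {0<..<1}" using r \<open>0 \<le> a\<close> \<open>b \<le> 1\<close> by auto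
    ultimately have "(\<zeta> has_vector_derivative g (\<zeta> r) (state f \<pi> y0 w t) (control \<pi> w t)) (at r within {0..1})"
      using sol fl unfolding hybrid_solution_def by fastforce
    moreover have "at r within {0..1} = at r"
      using \<open>r \<in> {0<..<1}\<close> by (intro at_within_interior) simp
    ultimately show ?thesis by simp
  qed
qed (use assms in auto)

text \<open>The solutions may be selected outcome by outcome in any way. Measurability starts from
  the constant initial value and passes from each jump time to the next as a pointwise limit of
  Euler polygons.\<close>

lemma measurable_hybrid_endpoint:
  fixes f :: "'y::second_countable_topology \<Rightarrow> 'u::second_countable_topology \<Rightarrow>
      's::second_countable_topology \<Rightarrow> 'y"
    and g :: "'n::{real_normed_vector, second_countable_topology} \<Rightarrow> 'y \<Rightarrow> 'u \<Rightarrow> 'n"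
  assumes "0 < \<epsilon>" and \<sigma>: "\<And>k. \<sigma> k \<in> borel_measurable M"
    and \<pi>: "\<pi> \<in> plans {..horizon \<epsilon>}"
    and Y: "y0 \<in> Y" "\<And>y u x. y \<in> Y \<Longrightarrow> f y u x \<in> Y"
    and f: "continuous_on (Y \<times> UNIV \<times> UNIV) (\<lambda>(y, u, x). f y u x)"
    and g: "continuous_on (UNIV \<times> Y \<times> UNIV) (\<lambda>(z, y, u). g z y u)"
    and lip: "\<And>y u. y \<in> Y \<Longrightarrow> C-lipschitz_on Z (\<lambda>z. g z y u)"
    and sol: "\<And>\<omega>. \<omega> \<in> space M \<Longrightarrow> hybrid_solution f g y0 z0 \<epsilon> \<pi> (\<lambda>k. \<sigma> k \<omega>) (\<zeta> \<omega>)"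
    and Z: "\<And>\<omega>. \<omega> \<in> space M \<Longrightarrow> \<zeta> \<omega> ` {0..1} \<subseteq> interior Z"
  shows "(\<lambda>\<omega>. \<zeta> \<omega> 1) \<in> borel_measurable M"
proof -
  have piece: "(\<lambda>\<omega>. \<zeta> \<omega> b) \<in> borel_measurable M"
    if m: "(\<lambda>\<omega>. \<zeta> \<omega> a) \<in> borel_measurable M" and "t \<le> horizon \<epsilon>"
      and ab: "\<epsilon> * real t = a" "a \<le> b" "b \<le> \<epsilon> * real (Suc t)" "b \<le> 1" for a b t
  proof (rule borel_measurable_LIMSEQ_metric)
    have p: "\<pi> k \<in> borel_measurable (PiM {..<k} (\<lambda>_. borel))" if "k \<le> t" for k
      using that \<open>t \<le> horizon \<epsilon>\<close> \<pi> by (auto simp: plans_def)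
    show "(\<lambda>\<omega>. ((\<lambda>x. x + ((b - a) / real N) *\<^sub>R
        g x (state f \<pi> y0 (\<lambda>k. \<sigma> k \<omega>) t) (control \<pi> (\<lambda>k. \<sigma> k \<omega>) t)) ^^ N) (\<zeta> \<omega> a)) \<in> borel_measurable M" for N
      using p by (intro measurable_euler[OF g] measurable_state[OF \<sigma> _ Y f] measurable_control \<sigma> m state_mem Y) auto
    show "(\<lambda>N. ((\<lambda>x. x + ((b - a) / real N) *\<^sub>R
        g x (state f \<pi> y0 (\<lambda>k. \<sigma> k \<omega>) t) (control \<pi> (\<lambda>k. \<sigma> k \<omega>) t)) ^^ N) (\<zeta> \<omega> a)) \<longlonglongrightarrow> \<zeta> \<omega> b"
      if "\<omega> \<in> space M" for \<omega>
      by (rule hybrid_solution_euler_tendsto[OF \<open>0 < \<epsilon>\<close> sol[OF that] Z[OF that] lip ab])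
        (rule state_mem[OF Y])
  qed
  have hor: "\<epsilon> * real (horizon \<epsilon>) \<le> 1 \<and> 1 \<le> \<epsilon> * real (Suc (horizon \<epsilon>))"
  proof -
    have "real (horizon \<epsilon>) = of_int \<lfloor>1 / \<epsilon>\<rfloor>" using \<open>0 < \<epsilon>\<close> by (simp add: horizon_def)
    then have "real (horizon \<epsilon>) \<le> 1 / \<epsilon>" "1 / \<epsilon> \<le> real (Suc (horizon \<epsilon>))" by linarith+
    then show ?thesis using \<open>0 < \<epsilon>\<close> by (simp add: field_simps)
  qed
  have "(\<lambda>\<omega>. \<zeta> \<omega> (\<epsilon> * real t)) \<in> borel_measurable M" if "t \<le> horizon \<epsilon>" for t
    using that
  proof (induction t)
    case 0
    have "\<zeta> \<omega> 0 = z0" if "\<omega> \<in> space M" for \<omega>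
      using sol[OF that] by (simp add: hybrid_solution_def)
    then show ?case by (simp cong: measurable_cong)
  next
    case (Suc t)
    have "\<epsilon> * real (Suc t) \<le> \<epsilon> * real (horizon \<epsilon>)"
      using Suc.prems \<open>0 < \<epsilon>\<close> by (intro mult_left_mono) auto
    also have "\<dots> \<le> 1" using hor ..
    finally show ?case
      using Suc hor \<open>0 < \<epsilon>\<close> by (intro piece[OF Suc.IH, of t]) auto
  qed
  \<comment> \<open>The final piece runs from the last jump time in the unit interval to 1 and may
    be shorter than \<open>\<epsilon>\<close>.\<close>
  from piece[OF this, of "horizon \<epsilon>" "horizon \<epsilon>"] show ?thesis using hor by simp
qed

section \<open>Expectations of Lipschitz functions\<close>

lemma (in prob_space) integrable_continuous_on_compact:
  fixes G :: "'b::{metric_space, second_countable_topology} \<Rightarrow> real"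
  assumes "continuous_on Z G" "compact Z" "X \<in> borel_measurable M" "\<And>\<omega>. \<omega> \<in> space M \<Longrightarrow> X \<omega> \<in> Z"
  shows "integrable M (\<lambda>\<omega>. G (X \<omega>))"
proof -
  obtain B where "\<And>z. z \<in> Z \<Longrightarrow> norm (G z) \<le> B"
    using compact_imp_bounded[OF compact_continuous_image[OF assms(1,2)]] by (auto simp: bounded_iff)
  then show ?thesis
    using assms measurable_continuous_on_comp[OF assms(1,3,4)] by (intro integrable_const_bound[where B = B]) auto
qed

text \<open>The pointwise Lipschitz inequality is integrated. Compactness of \<open>Z\<close>
  supplies integrability of all terms, without which a Bochner integral would take the default value
  0.\<close>

lemma (in prob_space) expectation_lipschitz_diff:
  fixes G :: "'b::{real_normed_vector, second_countable_topology} \<Rightarrow> real"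
  assumes G: "L-lipschitz_on Z G" and Z: "compact Z"
    and X: "X \<in> borel_measurable M" "\<And>\<omega>. \<omega> \<in> space M \<Longrightarrow> X \<omega> \<in> Z"
    and W: "W \<in> borel_measurable M" "\<And>\<omega>. \<omega> \<in> space M \<Longrightarrow> W \<omega> \<in> Z"
  shows "\<bar>expectation (\<lambda>\<omega>. G (X \<omega>)) - expectation (\<lambda>\<omega>. G (W \<omega>))\<bar> \<le> L * expectation (\<lambda>\<omega>. norm (X \<omega> - W \<omega>))"
proof -
  have cont: "continuous_on Z G" using G by (rule lipschitz_on_continuous_on)
  note int = integrable_continuous_on_compact[OF cont Z]
  have "integrable M (\<lambda>\<omega>. (\<lambda>p. norm (fst p - snd p)) (X \<omega>, W \<omega>))"
    using X W by (intro integrable_continuous_on_compact[of "Z \<times> Z"] compact_Times Z borel_measurable_Pair)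
      (auto intro!: continuous_intros)
  then have n: "integrable M (\<lambda>\<omega>. norm (X \<omega> - W \<omega>))" by simp
  have "\<bar>expectation (\<lambda>\<omega>. G (X \<omega>) - G (W \<omega>))\<bar> \<le> expectation (\<lambda>\<omega>. \<bar>G (X \<omega>) - G (W \<omega>)\<bar>)"
    by (rule integral_abs_bound)
  also have "\<dots> \<le> expectation (\<lambda>\<omega>. L * norm (X \<omega> - W \<omega>))"
    using lipschitz_onD[OF G X(2) W(2)]
    by (intro integral_mono integrable_abs Bochner_Integration.integrable_diff int X W integrable_mult_right n)
      (auto simp: dist_norm)
  finally show ?thesis by (simp add: int X W)
qed

section \<open>Comparison of the two optimal values\<close>

theorem corollary7p2:
  fixes M :: "'w measure"
    and \<sigma> :: "nat \<Rightarrow> 'w \<Rightarrow> 's::{metric_space, second_countable_topology}"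
    and f :: "real^'m \<Rightarrow> 'u::{metric_space, second_countable_topology} \<Rightarrow> 's \<Rightarrow> real^'m"
    and Y :: "(real^'m) set"
    and y0 :: "real^'m"
    and g :: "real^'n \<Rightarrow> real^'m \<Rightarrow> 'u \<Rightarrow> real^'n"
    and Z :: "(real^'n) set"
    and z0 :: "real^'n"
    and G :: "real^'n \<Rightarrow> real"
    and C C\<^sub>G \<epsilon>0 :: real
    and q :: "nat \<Rightarrow> (real^'m) \<times> 'u \<Rightarrow> real"
    and \<Delta> \<psi>1 \<psi>2 :: "real \<Rightarrow> real"
    and \<nu> :: "nat \<Rightarrow> real"
  defines "V \<equiv> averaged_velocities M \<sigma> f Y g"
    and "cost \<equiv> expected_cost M \<sigma> f g y0 z0 G"
    and "F\<epsilon> \<equiv> optimal_hybrid_value M \<sigma> f g y0 z0 G"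
    and "F0 \<equiv> optimal_averaged_value (averaged_velocities M \<sigma> f Y g) z0 G"
    and "\<psi> \<equiv> (\<lambda>\<epsilon>. max (\<psi>1 \<epsilon>) (\<psi>2 \<epsilon>))"
    and "constructed \<equiv> (\<lambda>zbar \<epsilon> \<pi>. constructed_plan M \<sigma> f Y g y0 \<nu> \<epsilon> (\<Delta> \<epsilon>) zbar \<pi>)"
  \<comment> \<open>the discrete-time system\<close>
  assumes "compact (UNIV :: 'u set)" and "compact (UNIV :: 's set)" and "compact Y" and "y0 \<in> Y"
    and "continuous_on (Y \<times> UNIV \<times> UNIV) (\<lambda>(y, u, x). f y u x)"
    and "\<And>y u x. y \<in> Y \<Longrightarrow> f y u x \<in> Y"
    and "prob_space M" and "prob_space.indep_vars M (\<lambda>_. borel) \<sigma> UNIV"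
    and "\<And>t. distr M borel (\<sigma> t) = distr M borel (\<sigma> 0)"
  \<comment> \<open>the strong approximation conditions\<close>
    and "\<And>i. \<exists>L. L-lipschitz_on (Y \<times> UNIV) (q i)" and "dense_in_unit_ball Y q"
    and "\<And>j. strong_approximation M \<sigma> f Y q j"
  \<comment> \<open>the hybrid system, for parameters below \<open>\<epsilon>0\<close>\<close>
    and "0 < \<epsilon>0"
    and "continuous_on (UNIV \<times> Y \<times> UNIV) (\<lambda>(z, y, u). g z y u)"
    and "compact Z" and "0 < C"
    and "\<And>z1 z2 y u. z1 \<in> Z \<Longrightarrow> z2 \<in> Z \<Longrightarrow> y \<in> Y \<Longrightarrow>
           norm (g z1 y u - g z2 y u) \<le> C * norm (z1 - z2)"
    and "\<And>\<epsilon> \<pi> \<omega>. \<epsilon> \<in> {0<..<\<epsilon>0} \<Longrightarrow> \<pi> \<in> plans {..horizon \<epsilon>} \<Longrightarrow> \<omega> \<in> space M \<Longrightarrow>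
           \<exists>\<zeta>. hybrid_solution f g y0 z0 \<epsilon> \<pi> (\<lambda>k. \<sigma> k \<omega>) \<zeta>"
    and "\<And>\<epsilon> \<pi> \<omega> \<zeta>. \<epsilon> \<in> {0<..<\<epsilon>0} \<Longrightarrow> \<pi> \<in> plans {..horizon \<epsilon>} \<Longrightarrow> \<omega> \<in> space M \<Longrightarrow>
           hybrid_solution f g y0 z0 \<epsilon> \<pi> (\<lambda>k. \<sigma> k \<omega>) \<zeta> \<Longrightarrow> \<zeta> ` {0..1} \<subseteq> interior Z"
    and "C\<^sub>G-lipschitz_on Z G"
  \<comment> \<open>the data of the construction\<close>
    and "(\<Delta> \<longlongrightarrow> 0) (at_right 0)" and "filterlim (\<lambda>\<epsilon>. \<Delta> \<epsilon> / \<epsilon>) at_top (at_right 0)"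
    and "\<And>\<epsilon>. \<epsilon> \<in> {0<..<\<epsilon>0} \<Longrightarrow> \<epsilon> \<le> \<Delta> \<epsilon> \<and> \<Delta> \<epsilon> \<le> 1"
    and "((\<lambda>\<epsilon>. \<nu> (block_length \<epsilon> (\<Delta> \<epsilon>))) \<longlongrightarrow> 0) (at_right 0)"
  \<comment> \<open>the approximation bounds\<close>
    and "approximation_bound_1 M \<sigma> f Y g y0 z0 \<epsilon>0 \<psi>1"
    and "approximation_bound_2 M \<sigma> f Y g y0 z0 q \<Delta> \<nu> \<epsilon>0 \<psi>2"
  shows "(F\<epsilon> \<longlongrightarrow> F0) (at_right 0)
    \<and> (\<forall>\<epsilon> \<in> {0<..<\<epsilon>0}. \<bar>F\<epsilon> \<epsilon> - F0\<bar> \<le> C\<^sub>G * \<psi> \<epsilon>)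
    \<and> (\<forall>zbar. inclusion_solution V z0 zbar \<and> G (zbar 1) = F0 \<longrightarrow>
         (\<forall>\<epsilon> \<in> {0<..<\<epsilon>0}. \<forall>\<pi>bar. constructed zbar \<epsilon> \<pi>bar \<longrightarrow>
            cost \<epsilon> \<pi>bar \<le> F\<epsilon> \<epsilon> + C\<^sub>G * (\<psi> \<epsilon> + \<psi>2 \<epsilon>)) \<and>
         (\<forall>\<pi>bar. (\<forall>\<epsilon> \<in> {0<..<\<epsilon>0}. constructed zbar \<epsilon> (\<pi>bar \<epsilon>)) \<longrightarrow>
            ((\<lambda>\<epsilon>. cost \<epsilon> (\<pi>bar \<epsilon>) - F\<epsilon> \<epsilon>) \<longlongrightarrow> 0) (at_right 0)))"
proof -
  interpret prob_space M by fact
  have \<sigma>: "\<sigma> k \<in> borel_measurable M" for k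
    using assms(14) unfolding indep_vars_def by auto
  define X where "X \<epsilon> \<pi> \<omega> = hybrid_traj f g y0 z0 \<epsilon> \<pi> (\<lambda>k. \<sigma> k \<omega>) 1" for \<epsilon> \<pi> \<omega>
  have sol: "hybrid_solution f g y0 z0 \<epsilon> \<pi> (\<lambda>k. \<sigma> k \<omega>) (hybrid_traj f g y0 z0 \<epsilon> \<pi> (\<lambda>k. \<sigma> k \<omega>))"
    if "\<epsilon> \<in> {0<..<\<epsilon>0}" "\<pi> \<in> plans {..horizon \<epsilon>}" "\<omega> \<in> space M" for \<epsilon> \<pi> \<omega>
    unfolding hybrid_traj_def using assms(24)[OF that] by (rule someI_ex)
  have lip: "C-lipschitz_on Z (\<lambda>z. g z y u)" if "y \<in> Y" for y u
    using assms(22,23) that by (intro lipschitz_onI) (auto simp: dist_norm)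
  have X: "X \<epsilon> \<pi> \<in> borel_measurable M" "\<And>\<omega>. \<omega> \<in> space M \<Longrightarrow> X \<epsilon> \<pi> \<omega> \<in> Z"
    if \<epsilon>: "\<epsilon> \<in> {0<..<\<epsilon>0}" and \<pi>: "\<pi> \<in> plans {..horizon \<epsilon>}" for \<epsilon> \<pi>
  proof -
    note Z = assms(25)[OF \<epsilon> \<pi> _ sol[OF \<epsilon> \<pi>]]
    show "X \<epsilon> \<pi> \<omega> \<in> Z" if "\<omega> \<in> space M" for \<omega>
      using image_subset_iff[THEN iffD1, OF Z[OF that that], rule_format, of 1] interior_subset[of Z]
      by (auto simp: X_def)
    show "X \<epsilon> \<pi> \<in> borel_measurable M"
      unfolding X_def
      by (rule measurable_hybrid_endpoint[OF _ \<sigma> \<pi> assms(10,12,11,20) lip sol[OF \<epsilon> \<pi>]])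
        (use Z \<epsilon> in auto)
  qed
  have cost: "cost \<epsilon> \<pi> = expectation (\<lambda>\<omega>. G (X \<epsilon> \<pi> \<omega>))" for \<epsilon> \<pi>
    by (simp add: cost_def expected_cost_def X_def)
  have GZ: "continuous_on Z G" using assms(26) by (rule lipschitz_on_continuous_on)
  have "C\<^sub>G \<ge> 0" using assms(26) by (rule lipschitz_on_nonneg)
  \<comment> \<open>A real infimum is a lower bound only for a set bounded below; \<open>B\<close>
    provides this for both optimal values.\<close>
  have "bdd_below (G ` Z)"
    by (intro bounded_imp_bdd_below compact_imp_bounded compact_continuous_image GZ assms(21))
  then obtain B where B: "\<And>z. z \<in> Z \<Longrightarrow> B \<le> G z" unfolding bdd_below_def by blast
  have ev: "\<forall>\<^sub>F \<epsilon> in at_right 0. \<epsilon> \<in> {0<..<\<epsilon>0}"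
    using \<open>0 < \<epsilon>0\<close> by (rule eventually_at_right_real)
  have \<psi>1: "(\<psi>1 \<longlongrightarrow> 0) (at_right 0)" and \<psi>2: "(\<psi>2 \<longlongrightarrow> 0) (at_right 0)"
    using assms(31,32) by (simp_all add: approximation_bound_1_def approximation_bound_2_def)
  \<comment> \<open>The strong approximation conditions enter here, discharging the premise of the
    second approximation property.\<close>
  have plan_ex: "\<exists>\<pi>. constructed zbar \<epsilon> \<pi>"
    and plan_bd: "\<And>\<pi>. constructed zbar \<epsilon> \<pi> \<Longrightarrow> expectation (\<lambda>\<omega>. norm (X \<epsilon> \<pi> \<omega> - zbar 1)) \<le> \<psi>2 \<epsilon>"
    if "inclusion_solution V z0 zbar" "\<epsilon> \<in> {0<..<\<epsilon>0}" for zbar \<epsilon>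
    using assms(32,18) that
    unfolding approximation_bound_2_def constructed_def V_def X_def by auto
  have con_plan: "\<pi> \<in> plans {..horizon \<epsilon>}" if "constructed zbar \<epsilon> \<pi>" for \<pi> \<epsilon> zbar
    using that by (simp add: constructed_def constructed_plan_def)

  \<comment> \<open>The Lipschitz bound for \<open>G\<close> holds only on \<open>Z\<close>, and \<open>Z\<close> is assumed to contain the
    solutions of the hybrid system only. The second approximation property and the closedness
    of \<open>Z\<close> put the endpoints of the solutions of the inclusion there as well.\<close>
  have inZ: "zbar 1 \<in> Z" if zbar: "inclusion_solution V z0 zbar" for zbar
  proof (rule ccontr)
    assume "zbar 1 \<notin> Z"
    then obtain d where "d > 0" and d: "\<And>x. x \<in> Z \<Longrightarrow> d \<le> norm (x - zbar 1)"
      using separate_point_closed[OF compact_imp_closed[OF assms(21)]]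
      by (metis dist_commute dist_norm)
    \<comment> \<open>Hybrid endpoints lie in \<open>Z\<close>, hence at least \<open>d\<close> away
      from \<open>zbar 1\<close> in every outcome; so their mean distance cannot tend to 0.\<close>
    have "d \<le> \<psi>2 \<epsilon>" if \<epsilon>: "\<epsilon> \<in> {0<..<\<epsilon>0}" for \<epsilon>
    proof -
      obtain \<pi> where \<pi>: "constructed zbar \<epsilon> \<pi>" using plan_ex[OF zbar \<epsilon>] by blast
      note X' = X[OF \<epsilon> con_plan[OF \<pi>]]
      have "integrable M (\<lambda>\<omega>. norm (X \<epsilon> \<pi> \<omega> - zbar 1))"
        by (rule integrable_continuous_on_compact[OF _ assms(21) X']) (auto intro!: continuous_intros)
      then have "d \<le> expectation (\<lambda>\<omega>. norm (X \<epsilon> \<pi> \<omega> - zbar 1))"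
        using d X'(2) by (intro integral_ge_const AE_I2) auto
      then show ?thesis using plan_bd[OF zbar \<epsilon> \<pi>] by simp
    qed
    then have "\<forall>\<^sub>F \<epsilon> in at_right 0. d \<le> \<psi>2 \<epsilon>" using ev by (auto elim: eventually_mono)
    then have "d \<le> 0" by (intro tendsto_lowerbound[OF \<psi>2]) auto
    then show False using \<open>d > 0\<close> by simp
  qed

  have F0_le: "F0 \<le> G (zbar 1)" if "inclusion_solution V z0 zbar" for zbar
    unfolding F0_def optimal_averaged_value_def
  proof (rule cINF_lower)
    show "bdd_below ((\<lambda>z. G (z 1)) ` {z. inclusion_solution (averaged_velocities M \<sigma> f Y g) z0 z})"
      using inZ B by (intro bdd_belowI2[where m = B]) (simp add: V_def)
  qed (use that in \<open>simp add: V_def\<close>)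
  have F\<epsilon>_le: "F\<epsilon> \<epsilon> \<le> cost \<epsilon> \<pi>" if \<epsilon>: "\<epsilon> \<in> {0<..<\<epsilon>0}" and \<pi>: "\<pi> \<in> plans {..horizon \<epsilon>}" for \<epsilon> \<pi>
    unfolding F\<epsilon>_def optimal_hybrid_value_def cost_def
  proof (rule cINF_lower[OF bdd_belowI2 \<pi>])
    fix \<pi> :: "('s, 'u) plan" assume "\<pi> \<in> plans {..horizon \<epsilon>}"
    note X' = X[OF \<epsilon> this]
    have "B \<le> cost \<epsilon> \<pi>"
      unfolding cost using X'(2) B
      by (intro integral_ge_const AE_I2 integrable_continuous_on_compact[OF GZ assms(21) X']) auto
    then show "B \<le> expected_cost M \<sigma> f g y0 z0 G \<epsilon> \<pi>" by (simp add: cost_def)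
  qed
  \<comment> \<open>The endpoint \<open>zbar 1\<close> is treated as a constant random
    variable.\<close>
  have upper: "cost \<epsilon> \<pi> \<le> G (zbar 1) + C\<^sub>G * \<psi>2 \<epsilon>"
    if zbar: "inclusion_solution V z0 zbar" and \<epsilon>: "\<epsilon> \<in> {0<..<\<epsilon>0}" and \<pi>: "constructed zbar \<epsilon> \<pi>" for zbar \<epsilon> \<pi>
  proof -
    have "\<bar>cost \<epsilon> \<pi> - G (zbar 1)\<bar> \<le> C\<^sub>G * expectation (\<lambda>\<omega>. norm (X \<epsilon> \<pi> \<omega> - zbar 1))"
      using expectation_lipschitz_diff[OF assms(26,21) X[OF \<epsilon> con_plan[OF \<pi>]], of "\<lambda>_. zbar 1"] inZ[OF zbar]
      by (simp add: cost prob_space)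
    also have "\<dots> \<le> C\<^sub>G * \<psi>2 \<epsilon>" using plan_bd[OF zbar \<epsilon> \<pi>] \<open>C\<^sub>G \<ge> 0\<close> by (rule mult_left_mono)
    finally show ?thesis by simp
  qed
  have z_ex: "\<exists>z. (\<forall>\<omega>\<in>space M. inclusion_solution V z0 (z \<omega>)) \<and> (\<lambda>\<omega>. z \<omega> 1) \<in> borel_measurable M \<and>
      expectation (\<lambda>\<omega>. norm (X \<epsilon> \<pi> \<omega> - z \<omega> 1)) \<le> \<psi>1 \<epsilon>"
    if "\<epsilon> \<in> {0<..<\<epsilon>0}" "\<pi> \<in> plans {..horizon \<epsilon>}" for \<epsilon> \<pi>
    using assms(31) that unfolding approximation_bound_1_def V_def X_def by fastforce
  have lower: "F0 - C\<^sub>G * \<psi>1 \<epsilon> \<le> cost \<epsilon> \<pi>"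
    if \<epsilon>: "\<epsilon> \<in> {0<..<\<epsilon>0}" and \<pi>: "\<pi> \<in> plans {..horizon \<epsilon>}" for \<epsilon> \<pi>
  proof -
    obtain z where z: "\<And>\<omega>. \<omega> \<in> space M \<Longrightarrow> inclusion_solution V z0 (z \<omega>)"
      "(\<lambda>\<omega>. z \<omega> 1) \<in> borel_measurable M" "expectation (\<lambda>\<omega>. norm (X \<epsilon> \<pi> \<omega> - z \<omega> 1)) \<le> \<psi>1 \<epsilon>"
      using z_ex[OF \<epsilon> \<pi>] by blast
    note zZ = inZ[OF z(1)]
    \<comment> \<open>The approximating solution may be random: \<open>F0\<close> bounds its cost
      from below in every outcome, hence also in the mean.\<close>
    have "F0 \<le> expectation (\<lambda>\<omega>. G (z \<omega> 1))"
      using F0_le[OF z(1)]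
      by (intro integral_ge_const AE_I2 integrable_continuous_on_compact[OF GZ assms(21) z(2)] zZ)
    moreover have "C\<^sub>G * expectation (\<lambda>\<omega>. norm (X \<epsilon> \<pi> \<omega> - z \<omega> 1)) \<le> C\<^sub>G * \<psi>1 \<epsilon>"
      using z(3) \<open>C\<^sub>G \<ge> 0\<close> by (rule mult_left_mono)
    ultimately show ?thesis
      using expectation_lipschitz_diff[OF assms(26,21) X[OF \<epsilon> \<pi>] z(2) zZ] unfolding cost by linarith
  qed
  \<comment> \<open>A constant control, whatever its value, shows that the infimum over plans is not
    taken over the empty set.\<close>
  have const_plan: "(\<lambda>_ _. undefined) \<in> (plans I :: ('s, 'u) plan set)" for I
    by (simp add: plans_def)
  have lower': "F0 - C\<^sub>G * \<psi>1 \<epsilon> \<le> F\<epsilon> \<epsilon>" if \<epsilon>: "\<epsilon> \<in> {0<..<\<epsilon>0}" for \<epsilon>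
    unfolding F\<epsilon>_def optimal_hybrid_value_def
    using const_plan lower[OF \<epsilon>] by (intro cINF_greatest) (auto simp: cost_def)
  \<comment> \<open>No minimizer is available here, so every solution of the inclusion is compared
    with its own constructed plan.\<close>
  have upper': "F\<epsilon> \<epsilon> - C\<^sub>G * \<psi>2 \<epsilon> \<le> F0" if \<epsilon>: "\<epsilon> \<in> {0<..<\<epsilon>0}" for \<epsilon>
    unfolding F0_def optimal_averaged_value_def
  proof (rule cINF_greatest)
    show "{z. inclusion_solution (averaged_velocities M \<sigma> f Y g) z0 z} \<noteq> {}"
      \<comment> \<open>The inclusion has a solution: the first property, applied to the constant
        plan, gives one for each outcome, and some outcome exists.\<close>
      using z_ex[OF \<epsilon> const_plan] not_empty unfolding V_def by blast
    fix z assume "z \<in> {z. inclusion_solution (averaged_velocities M \<sigma> f Y g) z0 z}"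
    then have z: "inclusion_solution V z0 z" by (simp add: V_def)
    obtain \<pi> where \<pi>: "constructed z \<epsilon> \<pi>" using plan_ex[OF z \<epsilon>] by blast
    show "F\<epsilon> \<epsilon> - C\<^sub>G * \<psi>2 \<epsilon> \<le> G (z 1)"
      using upper[OF z \<epsilon> \<pi>] F\<epsilon>_le[OF \<epsilon> con_plan[OF \<pi>]] by simp
  qed
  have bound: "\<bar>F\<epsilon> \<epsilon> - F0\<bar> \<le> C\<^sub>G * \<psi> \<epsilon>" if \<epsilon>: "\<epsilon> \<in> {0<..<\<epsilon>0}" for \<epsilon>
  proof -
    have "C\<^sub>G * \<psi>1 \<epsilon> \<le> C\<^sub>G * \<psi> \<epsilon>" "C\<^sub>G * \<psi>2 \<epsilon> \<le> C\<^sub>G * \<psi> \<epsilon>"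
      using \<open>C\<^sub>G \<ge> 0\<close> by (auto simp: \<psi>_def intro: mult_left_mono)
    then show ?thesis using lower'[OF \<epsilon>] upper'[OF \<epsilon>] by (simp add: abs_le_iff)
  qed
  have "(\<psi> \<longlongrightarrow> max 0 0) (at_right 0)" unfolding \<psi>_def by (intro tendsto_max \<psi>1 \<psi>2)
  then have \<psi>: "(\<psi> \<longlongrightarrow> 0) (at_right 0)" by simp
  have conv: "(F\<epsilon> \<longlongrightarrow> F0) (at_right 0)"
  proof (rule LIM_zero_cancel, rule Lim_null_comparison)
    show "\<forall>\<^sub>F \<epsilon> in at_right 0. norm (F\<epsilon> \<epsilon> - F0) \<le> C\<^sub>G * \<psi> \<epsilon>"
      using ev by eventually_elim (use bound in simp)
    show "((\<lambda>\<epsilon>. C\<^sub>G * \<psi> \<epsilon>) \<longlongrightarrow> 0) (at_right 0)" using \<psi> by (rule tendsto_mult_right_zero)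
  qed
  \<comment> \<open>Two errors add up: \<open>\<psi>2\<close> from the plan's cost to
    \<open>F0\<close>, and \<open>\<psi>\<close> from \<open>F0\<close> back to the hybrid
    optimum.\<close>
  have near: "cost \<epsilon> \<pi> \<le> F\<epsilon> \<epsilon> + C\<^sub>G * (\<psi> \<epsilon> + \<psi>2 \<epsilon>)"
    if "inclusion_solution V z0 zbar" "G (zbar 1) = F0" "\<epsilon> \<in> {0<..<\<epsilon>0}" "constructed zbar \<epsilon> \<pi>" for zbar \<epsilon> \<pi>
    using upper[OF that(1,3,4)] bound[OF that(3)] that(2) by (simp add: algebra_simps abs_le_iff)
  have "((\<lambda>\<epsilon>. cost \<epsilon> (\<pi>bar \<epsilon>) - F\<epsilon> \<epsilon>) \<longlongrightarrow> 0) (at_right 0)"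
    if zbar: "inclusion_solution V z0 zbar" "G (zbar 1) = F0"
      and \<pi>bar: "\<And>\<epsilon>. \<epsilon> \<in> {0<..<\<epsilon>0} \<Longrightarrow> constructed zbar \<epsilon> (\<pi>bar \<epsilon>)" for zbar \<pi>bar
  proof (rule Lim_null_comparison)
    show "\<forall>\<^sub>F \<epsilon> in at_right 0. norm (cost \<epsilon> (\<pi>bar \<epsilon>) - F\<epsilon> \<epsilon>) \<le> C\<^sub>G * (\<psi> \<epsilon> + \<psi>2 \<epsilon>)"
      using ev
    proof eventually_elim
      case (elim \<epsilon>)
      \<comment> \<open>The difference is nonnegative because the constructed plan is admissible, so
        the upper estimate bounds its absolute value.\<close>
      then show ?case
        using near[OF zbar elim \<pi>bar[OF elim]] F\<epsilon>_le[OF elim con_plan[OF \<pi>bar[OF elim]]] by simp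
    qed
    show "((\<lambda>\<epsilon>. C\<^sub>G * (\<psi> \<epsilon> + \<psi>2 \<epsilon>)) \<longlongrightarrow> 0) (at_right 0)"
      using \<psi> \<psi>2 by (intro tendsto_mult_right_zero tendsto_add_zero)
  qed
  then show ?thesis using conv bound near by blast
qed

end
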